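(* Let $K$ be a field, $S=K[x_1,\ldots,x_n]$, and let $I\subset S$ be a monomial ideal minimally generated by $m$ monomials. If $I$ has linear quotients, then $\operatorname{slength}(I)=m$.
   Context: Let $M$ be a finitely generated $\mathbb Z^n$-graded $S$-module, $S=K[x_1,\ldots,x_n]$. A Stanley decomposition of $M$ is a finite direct sum of $K$-vector spaces $\mathcal D: M=\bigoplus_{i=1}^r m_iK[Z_i]$, where each $m_i\in M$ is homogeneous, $Z_i\subset\{x_1,\ldots,x_n\}$, and $m_iK[Z_i]$ is a free $K[Z_i]$-module. Its length is $\operatorname{slength}(\mathcal D)=r$, and the Stanley length of $M$ is $\operatorname{slength}(M)=\min\{\operatorname{slength}(\mathcal D):\mathcal D\text{ is a Stanley decomposition of }M\}$. A monomial ideal $I$ has linear quotients if its minimal monomial generators can be ordered as $u_1,u_2,\ldots,u_m$ so that for every $2\leq j\leq m$ the ideal $(u_1,\ldots,u_{j-1}):u_j$ is generated by a subset of the variables. *)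

theory Defs
  imports Complex_Main "HOL-Library.Poly_Mapping"
begin

text \<open>
  The variables are indexed by a finite type \<open>'n\<close>, so \<open>n\<close> is its cardinality; an exponent
  vector is an element of \<open>'n \<Rightarrow>\<^sub>0 nat\<close>, and the library's convolution product
  makes \<open>('n, 'k) mpoly\<close> the polynomial ring.
\<close>

type_synonym ('n, 'k) mpoly = "('n \<Rightarrow>\<^sub>0 nat) \<Rightarrow>\<^sub>0 'k"

definition monom :: "('n \<Rightarrow>\<^sub>0 nat) \<Rightarrow> ('n, 'k::field) mpoly" where
  "monom t = Poly_Mapping.single t 1"

definition var :: "'n \<Rightarrow> ('n, 'k::field) mpoly" where
  "var i = monom (Poly_Mapping.single i 1)"

definition const :: "'k \<Rightarrow> ('n, 'k::field) mpoly" where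
  "const c = Poly_Mapping.single 0 c"

definition poly_subring :: "'n set \<Rightarrow> ('n, 'k::field) mpoly set" where
  "poly_subring Z = {f. \<forall>t \<in> Poly_Mapping.keys f. Poly_Mapping.keys t \<subseteq> Z}"

text \<open>The homogeneous components for the standard \<open>\<int>\<^sup>n\<close>-grading; they vanish outside
  \<open>\<nat>\<^sup>n\<close>.\<close>

definition poly_component :: "('n \<Rightarrow> int) \<Rightarrow> ('n, 'k::field) mpoly set" where
  "poly_component a = {f. \<forall>t \<in> Poly_Mapping.keys f. \<forall>i. int (Poly_Mapping.lookup t i) = a i}"


section \<open>Multigraded modules\<close>

text \<open>
  A module is a submodule \<open>M\<close> of an ambient type carrying an action \<open>scale\<close> of the polynomial
  ring; the constant polynomials make it a vector space over \<open>'k\<close>.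
\<close>

definition field_scale ::
  "(('n, 'k::field) mpoly \<Rightarrow> 'm::ab_group_add \<Rightarrow> 'm) \<Rightarrow> 'k \<Rightarrow> 'm \<Rightarrow> 'm" where
  "field_scale scale c v = scale (const c) v"

definition direct_sum_of_subspaces ::
  "(('n, 'k::field) mpoly \<Rightarrow> 'm::ab_group_add \<Rightarrow> 'm) \<Rightarrow> 'm set \<Rightarrow> 'j set \<Rightarrow> ('j \<Rightarrow> 'm set) \<Rightarrow> bool"
where
  "direct_sum_of_subspaces scale M J V \<longleftrightarrow>
     (\<forall>j \<in> J. V j \<subseteq> M \<and> module.subspace (field_scale scale) (V j)) \<and>
     (\<forall>v \<in> M. \<exists>!y. (\<forall>j \<in> J. y j \<in> V j) \<and> (\<forall>j. j \<notin> J \<longrightarrow> y j = 0) \<and>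
        finite {j. y j \<noteq> 0} \<and> v = (\<Sum>j | y j \<noteq> 0. y j))"

definition fg_multigraded_module ::
  "(('n, 'k::field) mpoly \<Rightarrow> 'm::ab_group_add \<Rightarrow> 'm) \<Rightarrow> 'm set \<Rightarrow> (('n \<Rightarrow> int) \<Rightarrow> 'm set) \<Rightarrow> bool"
where
  "fg_multigraded_module scale M G \<longleftrightarrow>
     module scale \<and>
     module.subspace scale M \<and>
     (\<exists>B. finite B \<and> M = module.span scale B) \<and>
     direct_sum_of_subspaces scale M UNIV G \<and>
     (\<forall>a b. \<forall>f \<in> poly_component a. \<forall>v \<in> G b. scale f v \<in> G (\<lambda>i. a i + b i))"


section \<open>Stanley decompositions\<close>

definition cyclic_subspace ::
  "(('n, 'k::field) mpoly \<Rightarrow> 'm::ab_group_add \<Rightarrow> 'm) \<Rightarrow> 'm \<Rightarrow> 'n set \<Rightarrow> 'm set" where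
  "cyclic_subspace scale u Z = {scale f u | f. f \<in> poly_subring Z}"

text \<open>\<open>N\<close> is free over the subring \<open>R\<close>, that is, has a basis.\<close>

definition free_over ::
  "('r::comm_ring_1 \<Rightarrow> 'm::ab_group_add \<Rightarrow> 'm) \<Rightarrow> 'r set \<Rightarrow> 'm set \<Rightarrow> bool" where
  "free_over scale R N \<longleftrightarrow>
     (\<exists>B \<subseteq> N.
        N = {(\<Sum>b\<in>F. scale (c b) b) | F c. finite F \<and> F \<subseteq> B \<and> (\<forall>b \<in> F. c b \<in> R)} \<and>
        (\<forall>F c. finite F \<and> F \<subseteq> B \<and> (\<forall>b \<in> F. c b \<in> R) \<and> (\<Sum>b\<in>F. scale (c b) b) = 0
           \<longrightarrow> (\<forall>b \<in> F. c b = 0)))"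

definition stanley_decomposition ::
  "(('n, 'k::field) mpoly \<Rightarrow> 'm::ab_group_add \<Rightarrow> 'm) \<Rightarrow> 'm set \<Rightarrow> (('n \<Rightarrow> int) \<Rightarrow> 'm set)
     \<Rightarrow> ('m \<times> 'n set) list \<Rightarrow> bool" where
  "stanley_decomposition scale M G D \<longleftrightarrow>
     (\<forall>(u, Z) \<in> set D. u \<in> M \<and> (\<exists>a. u \<in> G a) \<and>
        free_over scale (poly_subring Z) (cyclic_subspace scale u Z)) \<and>
     direct_sum_of_subspaces scale M {..<length D}
        (\<lambda>i. cyclic_subspace scale (fst (D ! i)) (snd (D ! i)))"

definition stanley_length ::
  "(('n, 'k::field) mpoly \<Rightarrow> 'm::ab_group_add \<Rightarrow> 'm) \<Rightarrow> 'm set \<Rightarrow> (('n \<Rightarrow> int) \<Rightarrow> 'm set) \<Rightarrow> nat"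
where
  "stanley_length scale M G = (LEAST r. \<exists>D. stanley_decomposition scale M G D \<and> length D = r)"


section \<open>Monomial ideals\<close>

abbreviation ideal_gen :: "('n, 'k::field) mpoly set \<Rightarrow> ('n, 'k) mpoly set" where
  "ideal_gen \<equiv> module.span (*)"

definition monomial_ideal :: "('n, 'k::field) mpoly set \<Rightarrow> bool" where
  "monomial_ideal I \<longleftrightarrow> (\<exists>A. I = ideal_gen (monom ` A))"

definition minimal_monomial_generators ::
  "('n, 'k::field) mpoly set \<Rightarrow> ('n, 'k) mpoly set \<Rightarrow> bool" where
  "minimal_monomial_generators I U \<longleftrightarrow>
     U \<subseteq> range monom \<and> ideal_gen U = I \<and> (\<forall>u \<in> U. ideal_gen (U - {u}) \<noteq> I)"

definition colon_ideal ::
  "('n, 'k::field) mpoly set \<Rightarrow> ('n, 'k) mpoly \<Rightarrow> ('n, 'k) mpoly set" where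
  "colon_ideal J u = {f. f * u \<in> J}"

text \<open>Lists are indexed from 0, so index 0 is the first generator, on which no condition
  is imposed.\<close>

definition linear_quotients :: "('n, 'k::field) mpoly set \<Rightarrow> bool" where
  "linear_quotients I \<longleftrightarrow>
     (\<exists>us. distinct us \<and> minimal_monomial_generators I (set us) \<and>
        (\<forall>j. 1 \<le> j \<and> j < length us \<longrightarrow>
           (\<exists>Z. colon_ideal (ideal_gen (set (take j us))) (us ! j) = ideal_gen (var ` Z))))"

definition ideal_grading ::
  "('n, 'k::field) mpoly set \<Rightarrow> ('n \<Rightarrow> int) \<Rightarrow> ('n, 'k) mpoly set" where
  "ideal_grading I a = I \<inter> poly_component a"


lemma module_mult: "module ((*) :: 'r::comm_ring_1 \<Rightarrow> 'r \<Rightarrow> 'r)"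
  by unfold_locales (auto simp: algebra_simps)

lemma module_field_scale_mult:
  "module (field_scale ((*) :: ('n, 'k::field) mpoly \<Rightarrow> _ \<Rightarrow> _))"
  by unfold_locales
    (auto simp: field_scale_def const_def algebra_simps single_add mult_single simp flip: mult.assoc)

lemma poly_decomp: "f = (\<Sum>t\<in>Poly_Mapping.keys f. Poly_Mapping.single t (Poly_Mapping.lookup f t))"
  for f :: "('n, 'k::field) mpoly"
  by (intro poly_mapping_eqI)
    (auto simp: lookup_sum lookup_single when_def in_keys_iff)

lemma mem_ideal_gen_monom:
  fixes f :: "('n, 'k::field) mpoly"
  shows "f \<in> ideal_gen (monom ` A) \<longleftrightarrow> (\<forall>t \<in> Poly_Mapping.keys f. \<exists>a \<in> A. \<exists>s. t = s + a)"
proof -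
  interpret m: module "(*) :: ('n, 'k) mpoly \<Rightarrow> _ \<Rightarrow> _" by (rule module_mult)
  show ?thesis
  proof
    assume "f \<in> ideal_gen (monom ` A)"
    then show "\<forall>t \<in> Poly_Mapping.keys f. \<exists>a \<in> A. \<exists>s. t = s + a"
    proof (induction rule: m.span_induct_alt)
      case base then show ?case by simp
    next
      case (step c x y)
      then obtain a where a: "a \<in> A" "x = monom a" by auto
      have "\<exists>a \<in> A. \<exists>s. t = s + a" if "t \<in> Poly_Mapping.keys (c * x)" for t
        using that keys_mult[of c x] a by (fastforce simp: monom_def)
      then show ?case using step.IH keys_add[of "c * x" y] by blast
    qed
  next
    assume *: "\<forall>t \<in> Poly_Mapping.keys f. \<exists>a \<in> A. \<exists>s. t = s + a"
    have "Poly_Mapping.single t (Poly_Mapping.lookup f t) \<in> ideal_gen (monom ` A)" if t: "t \<in> Poly_Mapping.keys f" for t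
    proof -
      obtain a s where a: "a \<in> A" "t = s + a" using * t by blast
      have "Poly_Mapping.single s (Poly_Mapping.lookup f t) * monom a \<in> ideal_gen (monom ` A)"
        using a by (intro m.span_scale m.span_base) auto
      then show ?thesis using a by (simp add: monom_def mult_single)
    qed
    then have "(\<Sum>t\<in>Poly_Mapping.keys f. Poly_Mapping.single t (Poly_Mapping.lookup f t)) \<in> ideal_gen (monom ` A)"
      by (intro m.span_sum) auto
    then show "f \<in> ideal_gen (monom ` A)" using poly_decomp[of f] by simp
  qed
qed

text \<open>Monomial ideals are indeed instances of \<open>fg_multigraded_module\<close>.\<close>

lemma fg_multigraded_module_monomial_ideal:
  fixes A :: "('n \<Rightarrow>\<^sub>0 nat) set"
  assumes fin: "finite A"
  defines "I \<equiv> ideal_gen (monom ` A) :: ('n, 'k::field) mpoly set"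
  shows "fg_multigraded_module (*) I (ideal_grading I)"
proof -
  let ?k = "Poly_Mapping.keys" and ?l = "Poly_Mapping.lookup"
  interpret m: module "(*) :: ('n, 'k) mpoly \<Rightarrow> _ \<Rightarrow> _" by (rule module_mult)
  interpret K: module "field_scale ((*) :: ('n, 'k) mpoly \<Rightarrow> _ \<Rightarrow> _)"
    by (rule module_field_scale_mult)
  have sub: "m.subspace I" unfolding I_def by (rule m.subspace_span)
  define e :: "('n \<Rightarrow>\<^sub>0 nat) \<Rightarrow> 'n \<Rightarrow> int" where "e = (\<lambda>t i. int (?l t i))"
  have inj: "inj e"
    by (auto simp: inj_def e_def fun_eq_iff intro!: poly_mapping_eqI)
  have comp: "f \<in> poly_component a \<longleftrightarrow> (\<forall>t\<in>?k f. e t = a)" for f :: "('n, 'k) mpoly" and a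
    by (auto simp: poly_component_def e_def fun_eq_iff)
  have comp_scale: "f * g \<in> poly_component (\<lambda>i. a i + b i)"
    if "f \<in> poly_component a" "g \<in> poly_component b" for f g :: "('n, 'k) mpoly" and a b
    using that keys_mult[of f g] unfolding comp
    by (force simp: e_def lookup_add fun_eq_iff)
  have const: "(const c :: ('n, 'k) mpoly) \<in> poly_component (\<lambda>_. 0)" for c :: 'k
    by (auto simp: comp const_def e_def)
  have ksub: "K.subspace (ideal_grading I a)" for a
  proof (rule K.subspaceI)
    show "0 \<in> ideal_grading I a"
      using m.subspace_0[OF sub] by (auto simp: ideal_grading_def comp)
    show "x + y \<in> ideal_grading I a" if "x \<in> ideal_grading I a" "y \<in> ideal_grading I a" for x y
      using that m.subspace_add[OF sub] keys_add[of x y] by (auto simp: ideal_grading_def comp)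
    show "field_scale (*) c x \<in> ideal_grading I a" if "x \<in> ideal_grading I a" for c x
      using that m.subspace_scale[OF sub] comp_scale[OF const]
      by (force simp: ideal_grading_def field_scale_def)
  qed
  have uniq: "\<exists>!y. (\<forall>a \<in> UNIV. y a \<in> ideal_grading I a) \<and> (\<forall>a. a \<notin> UNIV \<longrightarrow> y a = 0) \<and>
        finite {a. y a \<noteq> 0} \<and> f = (\<Sum>a | y a \<noteq> 0. y a)" if f: "f \<in> I" for f
  proof -
    define y where "y = (\<lambda>a. \<Sum>t | t \<in> ?k f \<and> e t = a. Poly_Mapping.single t (?l f t))"
    have ly: "?l (y a) t = (if e t = a then ?l f t else 0)" for a t
      unfolding y_def by (auto simp: lookup_sum lookup_single when_def in_keys_iff)
    have ky: "?k (y a) \<subseteq> {t \<in> ?k f. e t = a}" for a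
      by (auto simp: in_keys_iff ly split: if_splits)
    have supp: "{a. y a \<noteq> 0} \<subseteq> e ` ?k f"
    proof
      fix a assume "a \<in> {a. y a \<noteq> 0}"
      then have "?k (y a) \<noteq> {}" by simp
      then show "a \<in> e ` ?k f" using ky[of a] by blast
    qed
    then have finy: "finite {a. y a \<noteq> 0}" by (rule finite_subset) simp
    have lsum: "?l (\<Sum>a | z a \<noteq> 0. z a) t = ?l (z (e t)) t"
      if z: "\<And>a. z a \<in> ideal_grading I a" "finite {a. z a \<noteq> 0}" for z t
    proof -
      have "?l (z a) t = 0" if "a \<noteq> e t" for a
        using z(1)[of a] that by (auto simp: ideal_grading_def comp in_keys_iff)
      then have "(\<Sum>a | z a \<noteq> 0. ?l (z a) t) = (\<Sum>a\<in>{a. z a \<noteq> 0} \<inter> {e t}. ?l (z a) t)"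
        using z(2) by (intro sum.mono_neutral_right) auto
      also have "\<dots> = ?l (z (e t)) t" by (cases "z (e t) = 0") auto
      finally show ?thesis by (simp add: lookup_sum)
    qed
    have yI: "y a \<in> ideal_grading I a" for a
      using f ky[of a] unfolding I_def ideal_grading_def mem_ideal_gen_monom comp Int_iff by blast
    show ?thesis
    proof (rule ex1I[of _ y], intro conjI ballI)
      show "f = (\<Sum>a | y a \<noteq> 0. y a)"
        using lsum[OF yI finy] by (intro poly_mapping_eqI) (simp add: ly)
    next
      fix z assume z: "(\<forall>a \<in> UNIV. z a \<in> ideal_grading I a) \<and> (\<forall>a. a \<notin> UNIV \<longrightarrow> z a = 0) \<and>
        finite {a. z a \<noteq> 0} \<and> f = (\<Sum>a | z a \<noteq> 0. z a)"
      then have lz: "?l f t = ?l (z (e t)) t" for t using lsum[of z t] by simp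
      show "z = y"
      proof (intro ext poly_mapping_eqI)
        fix a t
        show "?l (z a) t = ?l (y a) t"
        proof (cases "e t = a")
          case True then show ?thesis using lz[of t] ly[of a t] by simp
        next
          case False
          have "z a \<in> ideal_grading I a" using z by simp
          then show ?thesis using False by (auto simp: ly ideal_grading_def comp in_keys_iff)
        qed
      qed
    qed (use yI finy in auto)
  qed
  show ?thesis
    unfolding fg_multigraded_module_def direct_sum_of_subspaces_def
  proof (intro conjI ballI allI)
    show "\<exists>B. finite B \<and> I = ideal_gen B" using fin unfolding I_def by blast
    show "f * v \<in> ideal_grading I (\<lambda>i. a i + b i)"
      if "f \<in> poly_component a" "v \<in> ideal_grading I b" for f v a b
      using that comp_scale m.subspace_scale[OF sub] by (auto simp: ideal_grading_def)
  qed (use ksub uniq sub module_mult in \<open>auto simp: ideal_grading_def\<close>)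
qed

end

theory Submission
  imports Defs "HOL-Library.Disjoint_Sets"
begin

text \<open>
  A minimal generator is divisible by no other monomial of \<open>I\<close>, so a Stanley space whose elements
  involve it must be spanned from the generator itself; this gives \<open>m\<close> different summands in any
  decomposition. Conversely, let \<open>W\<^sub>j\<close> be the set of variables not in the colon ideal of \<open>u\<^sub>j\<close>.
  The monomials of \<open>u\<^sub>j K[W\<^sub>j]\<close> are exactly those whose first divisor in the list is \<open>u\<^sub>j\<close>, so the
  spaces \<open>u\<^sub>j K[W\<^sub>j]\<close> decompose \<open>I\<close>.
\<close>

section \<open>Products with a monomial and their supports\<close>

lemma keys_monom [simp]: "Poly_Mapping.keys (monom t :: ('n, 'k::field) mpoly) = {t}"
  by (simp add: monom_def)

lemma inj_monom: "inj (monom :: _ \<Rightarrow> ('n, 'k::field) mpoly)"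
  by (rule injI) (metis keys_monom singleton_inject)

lemma monom_mult: "monom s * monom t = (monom (s + t) :: ('n, 'k::field) mpoly)"
  by (simp add: monom_def mult_single)

lemma monom_in_ideal_gen:
  "(monom t :: ('n, 'k::field) mpoly) \<in> ideal_gen (monom ` A) \<longleftrightarrow> (\<exists>a\<in>A. \<exists>s. t = s + a)"
  by (simp add: mem_ideal_gen_monom)

lemma lookup_times_monom:
  fixes f :: "('n, 'k::field) mpoly"
  shows "Poly_Mapping.lookup (f * monom t) (s + t) = Poly_Mapping.lookup f s"
proof -
  have "f * monom t =
      (\<Sum>r\<in>Poly_Mapping.keys f. Poly_Mapping.single (r + t) (Poly_Mapping.lookup f r))"
    by (subst poly_decomp[of f]) (simp add: sum_distrib_right monom_def mult_single)
  then show ?thesis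
    by (simp add: lookup_sum lookup_single when_def in_keys_iff)
qed

text \<open>\<open>keys_mult\<close> gives one inclusion. The other holds because exponents are
  translated injectively by \<open>t\<close>, so no two terms of the product can cancel.\<close>

lemma keys_times_monom:
  fixes f :: "('n, 'k::field) mpoly"
  shows "Poly_Mapping.keys (f * monom t) = (\<lambda>s. s + t) ` Poly_Mapping.keys f"
proof
  show "Poly_Mapping.keys (f * monom t) \<subseteq> (\<lambda>s. s + t) ` Poly_Mapping.keys f"
    using keys_mult[of f "monom t"] by auto
  show "(\<lambda>s. s + t) ` Poly_Mapping.keys f \<subseteq> Poly_Mapping.keys (f * monom t)"
    by (auto simp: in_keys_iff lookup_times_monom)
qed

lemma times_monom_eq_0_iff:
  fixes f :: "('n, 'k::field) mpoly"
  shows "f * monom t = 0 \<longleftrightarrow> f = 0"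
  by (metis keys_eq_empty keys_times_monom image_is_empty)


section \<open>Spaces of polynomials with prescribed support\<close>

text \<open>A Stanley space on a monomial is determined by its set of exponents alone, so
  decomposing \<open>I\<close> reduces to partitioning a set of exponents.\<close>

lemma cyclic_subspace_monom:
  "cyclic_subspace (*) (monom t :: ('n, 'k::field) mpoly) Z =
     {g. Poly_Mapping.keys g \<subseteq> {s + t | s. Poly_Mapping.keys s \<subseteq> Z}}" (is "_ = ?R")
proof (intro set_eqI iffI)
  fix g :: "('n, 'k) mpoly"
  assume "g \<in> cyclic_subspace (*) (monom t) Z"
  then show "g \<in> ?R"
    by (auto simp: cyclic_subspace_def poly_subring_def keys_times_monom)
next
  fix g :: "('n, 'k) mpoly"
  assume g: "g \<in> ?R"
  \<comment> \<open>This is \<open>g\<close> divided by \<open>monom t\<close>. Subtraction of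
    exponents is truncated, so \<open>sub\<close> checks that it is exact on the support of
    \<open>g\<close>.\<close>
  define f where
    "f = (\<Sum>r\<in>Poly_Mapping.keys g. Poly_Mapping.single (r - t) (Poly_Mapping.lookup g r))"
  have sub: "r - t + t = r" "Poly_Mapping.keys (r - t) \<subseteq> Z" if r: "r \<in> Poly_Mapping.keys g" for r
  proof -
    obtain s where "r = s + t" "Poly_Mapping.keys s \<subseteq> Z" using g r by blast
    then show "r - t + t = r" "Poly_Mapping.keys (r - t) \<subseteq> Z" by simp_all
  qed
  have "f * monom t =
      (\<Sum>r\<in>Poly_Mapping.keys g. Poly_Mapping.single r (Poly_Mapping.lookup g r))"
    unfolding f_def sum_distrib_right monom_def
    by (intro sum.cong) (simp_all add: mult_single sub)
  then have fg: "f * monom t = g"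
    using poly_decomp[of g] by simp
  have "f \<in> poly_subring Z"
    unfolding poly_subring_def
  proof (intro CollectI ballI)
    fix s assume "s \<in> Poly_Mapping.keys f"
    then have "s + t \<in> Poly_Mapping.keys g"
      by (auto simp: keys_times_monom simp flip: fg)
    then show "Poly_Mapping.keys s \<subseteq> Z"
      using sub(2) by fastforce
  qed
  with fg show "g \<in> cyclic_subspace (*) (monom t) Z"
    by (auto simp: cyclic_subspace_def)
qed

text \<open>The basis is the single element \<open>monom t\<close>; its independence says that a
  monomial is not a zero divisor.\<close>

lemma free_over_cyclic_subspace_monom:
  "free_over (*) (poly_subring Z) (cyclic_subspace (*) (monom t :: ('n, 'k::field) mpoly) Z)"
  unfolding free_over_def
proof (intro exI[of _ "{monom t}"] conjI allI impI)
  have one: "(1 :: ('n, 'k) mpoly) \<in> poly_subring Z"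
    by (auto simp: poly_subring_def simp flip: single_one)
  have zero: "(0 :: ('n, 'k) mpoly) \<in> poly_subring Z"
    by (simp add: poly_subring_def)
  show "{monom t} \<subseteq> cyclic_subspace (*) (monom t :: ('n, 'k) mpoly) Z"
    using one by (force simp: cyclic_subspace_def)
  show "cyclic_subspace (*) (monom t :: ('n, 'k) mpoly) Z =
    {\<Sum>b\<in>F. c b * b |F c. finite F \<and> F \<subseteq> {monom t} \<and> (\<forall>b\<in>F. c b \<in> poly_subring Z)}"
    (is "_ = ?R")
  proof (intro set_eqI iffI)
    fix g :: "('n, 'k) mpoly"
    assume "g \<in> cyclic_subspace (*) (monom t) Z"
    then obtain f where "f \<in> poly_subring Z" "g = f * monom t"
      by (auto simp: cyclic_subspace_def)
    then show "g \<in> ?R"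
      by (intro CollectI exI[of _ "{monom t}"] exI[of _ "\<lambda>_. f"]) simp
  next
    fix g :: "('n, 'k) mpoly"
    assume "g \<in> ?R"
    \<comment> \<open>\<open>F\<close> is empty or \<open>{monom t}\<close>; the empty sum is the
      multiple of \<open>monom t\<close> with coefficient 0.\<close>
    then show "g \<in> cyclic_subspace (*) (monom t) Z"
      using zero mult_zero_left[of "monom t"]
      by (force simp: cyclic_subspace_def subset_singleton_iff)
  qed
next
  fix F and c :: "('n, 'k) mpoly \<Rightarrow> ('n, 'k) mpoly"
  assume "finite F \<and> F \<subseteq> {monom t} \<and> (\<forall>b\<in>F. c b \<in> poly_subring Z) \<and> (\<Sum>b\<in>F. c b * b) = 0"
  then show "\<forall>b\<in>F. c b = 0"
    by (auto simp: subset_singleton_iff times_monom_eq_0_iff)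
qed

text \<open>Each exponent in the support of an element of \<open>M\<close> lies in exactly one block
  \<open>P j\<close>, so its coefficient has exactly one summand to go to.\<close>

lemma direct_sum_of_supports:
  fixes P :: "'j \<Rightarrow> ('n \<Rightarrow>\<^sub>0 nat) set" and V :: "'j \<Rightarrow> ('n, 'k::field) mpoly set"
  assumes fin: "finite J"
    and disj: "disjoint_family_on P J"
    and V: "\<And>j. j \<in> J \<Longrightarrow> V j = {g. Poly_Mapping.keys g \<subseteq> P j}"
    and M: "M = {g. Poly_Mapping.keys g \<subseteq> (\<Union>j\<in>J. P j)}"
  shows "direct_sum_of_subspaces (*) M J V"
  unfolding direct_sum_of_subspaces_def
proof (intro conjI ballI)
  let ?k = "Poly_Mapping.keys"
  interpret K: module "field_scale ((*) :: ('n, 'k) mpoly \<Rightarrow> _ \<Rightarrow> _)"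
    by (rule module_field_scale_mult)
  fix j assume j: "j \<in> J"
  show "V j \<subseteq> M" using j by (auto simp: V M)
  show "K.subspace (V j)"
  proof (rule K.subspaceI)
    fix x y assume "x \<in> V j" "y \<in> V j"
    then show "x + y \<in> V j"
      using j Poly_Mapping.keys_add[of x y] by (auto simp: V)
  next
    fix c x assume "x \<in> V j"
    moreover have "?k (const c * x) \<subseteq> ?k x"
      using keys_mult[of "const c" x] by (auto simp: const_def split: if_splits)
    ultimately show "field_scale (*) c x \<in> V j"
      using j by (auto simp: V field_scale_def)
  qed (use j in \<open>simp add: V\<close>)
next
  let ?l = "Poly_Mapping.lookup" and ?k = "Poly_Mapping.keys"
  have VP: "t \<in> P j" if "j \<in> J" "x \<in> V j" "?l x t \<noteq> 0" for x j t
    using that V[of j] by (auto simp flip: in_keys_iff)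
  fix v assume v: "v \<in> M"
  \<comment> \<open>The summand for \<open>j\<close> is the restriction of \<open>v\<close> to the
    exponents in \<open>P j\<close>; the value 0 off \<open>J\<close> is the one that
    \<open>direct_sum_of_subspaces\<close> prescribes.\<close>
  define y where "y j =
      (if j \<in> J then \<Sum>t\<in>?k v \<inter> P j. Poly_Mapping.single t (?l v t) else 0)" for j
  have ly: "?l (y j) t = (if j \<in> J \<and> t \<in> P j then ?l v t else 0)" for j t
    by (auto simp: y_def lookup_sum lookup_single when_def in_keys_iff)
  have supp: "{j. z j \<noteq> 0} \<subseteq> J" if "\<forall>j. j \<notin> J \<longrightarrow> z j = 0" for z :: "'j \<Rightarrow> ('n, 'k) mpoly"
    using that by auto
  \<comment> \<open>At an exponent of block \<open>i\<close> all other summands vanish. For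
    \<open>y\<close> this yields existence, and for an arbitrary candidate \<open>z\<close> it
    yields uniqueness.\<close>
  have sum: "?l (\<Sum>j | z j \<noteq> 0. z j) t = ?l (z i) t"
    if z: "\<forall>j\<in>J. z j \<in> V j" "\<forall>j. j \<notin> J \<longrightarrow> z j = 0" and i: "i \<in> J" "t \<in> P i" for z t i
  proof -
    have "(\<Sum>j | z j \<noteq> 0. z j) = (\<Sum>j\<in>J. z j)"
      using supp[OF z(2)] fin by (intro sum.mono_neutral_left) auto
    then have "?l (\<Sum>j | z j \<noteq> 0. z j) t = (\<Sum>j\<in>J. ?l (z j) t)"
      by (simp add: lookup_sum)
    also have "\<dots> = (\<Sum>j\<in>{i}. ?l (z j) t)"
    proof (intro sum.mono_neutral_right ballI)
      fix j assume j: "j \<in> J - {i}"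
      then have "t \<notin> P j"
        using disj i by (auto simp: disjoint_family_on_def)
      then show "?l (z j) t = 0"
        using z(1) j VP by blast
    qed (use fin i in auto)
    finally show ?thesis by simp
  qed
  have sum0: "?l (\<Sum>j | z j \<noteq> 0. z j) t = 0"
    if z: "\<forall>j\<in>J. z j \<in> V j" "\<forall>j. j \<notin> J \<longrightarrow> z j = 0" and t: "t \<notin> (\<Union>j\<in>J. P j)" for z t
  proof -
    have "?l (z j) t = 0" if "z j \<noteq> 0" for j
      using z t that VP by blast
    then show ?thesis by (simp add: lookup_sum)
  qed
  have yV: "\<forall>j\<in>J. y j \<in> V j"
    by (auto simp: V in_keys_iff ly split: if_splits)
  have y0: "\<forall>j. j \<notin> J \<longrightarrow> y j = 0"
    by (simp add: y_def)
  show "\<exists>!y. (\<forall>j \<in> J. y j \<in> V j) \<and> (\<forall>j. j \<notin> J \<longrightarrow> y j = 0) \<and>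
        finite {j. y j \<noteq> 0} \<and> v = (\<Sum>j | y j \<noteq> 0. y j)"
  proof (rule ex1I[of _ y], intro conjI)
    show "finite {j. y j \<noteq> 0}"
      using supp[OF y0] fin by (rule finite_subset)
    show "v = (\<Sum>j | y j \<noteq> 0. y j)"
    proof (rule poly_mapping_eqI)
      fix t
      show "?l v t = ?l (\<Sum>j | y j \<noteq> 0. y j) t"
      proof (cases "t \<in> (\<Union>j\<in>J. P j)")
        case True
        then obtain i where "i \<in> J" "t \<in> P i" by blast
        then show ?thesis using sum[OF yV y0] by (simp add: ly)
      next
        case False
        then have "?l v t = 0" using v by (auto simp: M in_keys_iff)
        then show ?thesis using sum0[OF yV y0 False] by simp
      qed
    qed
  next
    fix z assume z: "(\<forall>j \<in> J. z j \<in> V j) \<and> (\<forall>j. j \<notin> J \<longrightarrow> z j = 0) \<and>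
        finite {j. z j \<noteq> 0} \<and> v = (\<Sum>j | z j \<noteq> 0. z j)"
    show "z = y"
    proof (intro ext poly_mapping_eqI)
      fix j t
      show "?l (z j) t = ?l (y j) t"
      proof (cases "j \<in> J \<and> t \<in> P j")
        case True
        then show ?thesis using z sum[of z j t] by (simp add: ly)
      next
        case False
        \<comment> \<open>Off its block, or off \<open>J\<close>, the coefficient of either summand
          is 0.\<close>
        then show ?thesis using z VP by (metis ly lookup_zero)
      qed
    qed
  qed (use yV y0 in auto)
qed


section \<open>Minimal generators\<close>

text \<open>Some generator \<open>b\<close> divides \<open>a\<close>, hence divides
  \<open>t\<close>. If \<open>b\<close> differed from \<open>t\<close>, every multiple of
  \<open>t\<close> would be a multiple of \<open>b\<close>, and \<open>t\<close> could be deleted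
  from the generators. So \<open>b = t\<close>, and \<open>a\<close> and \<open>t\<close> divide
  each other.\<close>

lemma minimal_monomial_generator_divisor_eq:
  fixes I :: "('n, 'k::field) mpoly set"
  assumes min: "minimal_monomial_generators I (monom ` A)"
    and t: "t \<in> A" and div: "t = s + a" and a: "monom a \<in> I"
  shows "a = t"
proof -
  have I: "I = ideal_gen (monom ` A)"
    using min by (simp add: minimal_monomial_generators_def)
  have del: "monom ` A - {monom t} = (monom ` (A - {t}) :: ('n, 'k) mpoly set)"
    using t by (auto dest: injD[OF inj_monom])
  obtain b r where b: "b \<in> A" "a = r + b"
    using a by (auto simp: I monom_in_ideal_gen)
  have "b = t"
  proof (rule ccontr)
    assume "b \<noteq> t"
    have "(f \<in> ideal_gen (monom ` (A - {t}))) = (f \<in> ideal_gen (monom ` A))"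
      for f :: "('n, 'k) mpoly"
      unfolding mem_ideal_gen_monom
    proof (intro ball_cong refl iffI)
      fix q assume "\<exists>a\<in>A. \<exists>s. q = s + a"
      then obtain c p where c: "c \<in> A" "q = p + c" by blast
      show "\<exists>a\<in>A - {t}. \<exists>s. q = s + a"
      proof (cases "c = t")
        case True
        then have "q = (p + s + r) + b" using c div b by (simp add: add.assoc)
        then show ?thesis using b \<open>b \<noteq> t\<close> by blast
      qed (use c in blast)
    qed blast
    then have "ideal_gen (monom ` A - {monom t}) = I"
      unfolding I del by blast
    then show False using min t by (auto simp: minimal_monomial_generators_def)
  qed
  \<comment> \<open>Cancelling \<open>t\<close> leaves \<open>s + r = 0\<close>; natural exponents
    then force \<open>s = 0\<close>.\<close>
  then have "s + r + t = 0 + t" using div b by (simp add: add.assoc)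
  then have "s + r = 0" by (simp only: add_right_cancel)
  then have "s = 0" by (metis add_eq_0_iff_both_eq_0 lookup_add lookup_zero poly_mapping_eqI)
  then show ?thesis using div by simp
qed

text \<open>Used in both directions, this makes the minimal monomial generating set unique, so the
  ordering behind linear quotients enumerates the given generators.\<close>

lemma minimal_monomial_generators_subset:
  fixes I :: "('n, 'k::field) mpoly set"
  assumes A: "minimal_monomial_generators I (monom ` A)"
    and B: "minimal_monomial_generators I (monom ` B)"
  shows "A \<subseteq> B"
proof
  fix t assume t: "t \<in> A"
  have I: "I = ideal_gen (monom ` A)" "I = ideal_gen (monom ` B)"
    using A B by (simp_all add: minimal_monomial_generators_def)
  have "monom t \<in> I"
    using t unfolding I(1) monom_in_ideal_gen by (metis add_0)
  then obtain b s where b: "b \<in> B" "t = s + b"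
    unfolding I(2) monom_in_ideal_gen by blast
  moreover have "monom b \<in> I"
    using b unfolding I(2) monom_in_ideal_gen by (metis add_0)
  ultimately show "t \<in> B"
    using minimal_monomial_generator_divisor_eq[OF A t] by metis
qed

text \<open>The lower bound: each minimal generator is assigned a Stanley space whose own generator
  has it in its support, and homogeneity makes the assignment injective.\<close>

lemma card_le_length_stanley_decomposition:
  fixes I :: "('n, 'k::field) mpoly set"
  assumes min: "minimal_monomial_generators I (monom ` A)"
    and D: "stanley_decomposition (*) I (ideal_grading I) D"
  shows "card A \<le> length D"
proof -
  let ?k = "Poly_Mapping.keys"
  have I: "I = ideal_gen (monom ` A)"
    using min by (simp add: minimal_monomial_generators_def)
  have "\<exists>i<length D. t \<in> ?k (fst (D ! i))" if t: "t \<in> A" for t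
  proof -
    have "monom t \<in> I"
      using t unfolding I monom_in_ideal_gen by (metis add_0)
    with D have "\<exists>!y.
        (\<forall>j\<in>{..<length D}. y j \<in> cyclic_subspace (*) (fst (D ! j)) (snd (D ! j))) \<and>
        (\<forall>j. j \<notin> {..<length D} \<longrightarrow> y j = 0) \<and> finite {j. y j \<noteq> 0} \<and>
        monom t = (\<Sum>j | y j \<noteq> 0. y j)"
      unfolding stanley_decomposition_def direct_sum_of_subspaces_def by simp
    from ex1_implies_ex[OF this] obtain y where
      y: "\<forall>j<length D. y j \<in> cyclic_subspace (*) (fst (D ! j)) (snd (D ! j))"
        "\<forall>j. \<not> j < length D \<longrightarrow> y j = 0" "monom t = (\<Sum>j | y j \<noteq> 0. y j)"
      by auto
    have "t \<in> ?k (\<Sum>j | y j \<noteq> 0. y j)"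
      by (simp flip: y(3))
    then obtain j where j: "t \<in> ?k (y j)"
      using keys_sum[of y "{j. y j \<noteq> 0}"] by auto
    then have jl: "j < length D" using y(2) by (metis empty_iff keys_zero)
    then obtain f where "y j = f * fst (D ! j)"
      using y(1) by (auto simp: cyclic_subspace_def)
    then obtain s b where b: "b \<in> ?k (fst (D ! j))" "t = s + b"
      using j keys_mult by fastforce
    have "fst (D ! j) \<in> I"
      using D nth_mem[OF jl] by (auto simp: stanley_decomposition_def case_prod_beta)
    \<comment> \<open>A monomial ideal contains every monomial in the support of its elements, so
      the minimality of \<open>t\<close> applies to the single exponent \<open>b\<close>, which
      divides \<open>t\<close>.\<close>
    then have "monom b \<in> I"
      using b unfolding I mem_ideal_gen_monom by simp
    then have "b = t"
      using minimal_monomial_generator_divisor_eq[OF min t b(2)] by blast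
    then show ?thesis using b jl by blast
  qed
  then obtain i where i: "\<And>t. t \<in> A \<Longrightarrow> i t < length D \<and> t \<in> ?k (fst (D ! i t))"
    by metis
  have "inj_on i A"
  proof (rule inj_onI)
    fix s t assume st: "s \<in> A" "t \<in> A" "i s = i t"
    have "D ! i t \<in> set D" using i[OF st(2)] by simp
    then obtain a where "fst (D ! i t) \<in> poly_component a"
      using D by (fastforce simp: stanley_decomposition_def ideal_grading_def case_prod_beta)
    \<comment> \<open>Both exponents occur in the same homogeneous element, so each equals its
      multidegree.\<close>
    then have "int (Poly_Mapping.lookup s x) = int (Poly_Mapping.lookup t x)" for x
      using i[OF st(1)] i[OF st(2)] st(3) by (simp add: poly_component_def)
    then show "s = t" by (intro poly_mapping_eqI) simp
  qed
  then have "card A \<le> card {..<length D}"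
    using i by (intro card_inj_on_le[of i]) auto
  then show ?thesis by simp
qed


section \<open>The decomposition given by linear quotients\<close>

text \<open>Both sides express that \<open>monom s\<close> lies in the colon ideal: on the left by
  its definition, on the right by divisibility by one of the variables in \<open>Z\<close>.\<close>

lemma colon_ideal_monom_eq_vars:
  assumes "colon_ideal (ideal_gen (monom ` A)) (monom t :: ('n, 'k::field) mpoly)
             = ideal_gen (var ` Z)"
  shows "(\<exists>a\<in>A. \<exists>r. s + t = r + a) \<longleftrightarrow> Poly_Mapping.keys s \<inter> Z \<noteq> {}"
proof -
  have var: "var ` Z = (monom ` (\<lambda>i. Poly_Mapping.single i 1) ` Z :: ('n, 'k) mpoly set)"
    by (auto simp: var_def)
  have "(\<exists>a\<in>A. \<exists>r. s + t = r + a) \<longleftrightarrow> (monom s :: ('n, 'k) mpoly) \<in> ideal_gen (var ` Z)"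
    by (simp add: colon_ideal_def monom_mult monom_in_ideal_gen flip: assms)
  also have "\<dots> \<longleftrightarrow> (\<exists>i\<in>Z. \<exists>r. s = r + Poly_Mapping.single i 1)"
    unfolding var monom_in_ideal_gen by blast
  also have "\<dots> \<longleftrightarrow> Poly_Mapping.keys s \<inter> Z \<noteq> {}"
  proof
    assume "Poly_Mapping.keys s \<inter> Z \<noteq> {}"
    then obtain i where i: "i \<in> Z" "Poly_Mapping.lookup s i \<noteq> 0"
      by (auto simp: in_keys_iff)
    \<comment> \<open>Truncated subtraction is exact here because \<open>i\<close> occurs in
      \<open>s\<close>.\<close>
    then have "s = (s - Poly_Mapping.single i 1) + Poly_Mapping.single i 1"
      by (intro poly_mapping_eqI) (auto simp: lookup_add lookup_minus lookup_single when_def)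
    with i show "\<exists>i\<in>Z. \<exists>r. s = r + Poly_Mapping.single i 1" by blast
  next
    assume "\<exists>i\<in>Z. \<exists>r. s = r + Poly_Mapping.single i 1"
    then obtain i r where "i \<in> Z" "s = r + Poly_Mapping.single i 1" by blast
    then have "i \<in> Poly_Mapping.keys s \<inter> Z"
      by (simp add: in_keys_iff lookup_add)
    then show "Poly_Mapping.keys s \<inter> Z \<noteq> {}" by blast
  qed
  finally show ?thesis .
qed

text \<open>The upper bound: one Stanley space per list entry, with \<open>- Z j\<close> as the set
  of free variables.\<close>

lemma stanley_decomposition_linear_quotients:
  fixes ts :: "('n \<Rightarrow>\<^sub>0 nat) list"
  defines "I \<equiv> ideal_gen (monom ` set ts) :: ('n, 'k::field) mpoly set"
  assumes lin: "\<And>j. \<lbrakk>1 \<le> j; j < length ts\<rbrakk> \<Longrightarrow>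
      \<exists>Z. colon_ideal (ideal_gen (monom ` set (take j ts))) (monom (ts ! j) :: ('n, 'k) mpoly)
          = ideal_gen (var ` Z)"
  shows "\<exists>D. stanley_decomposition (*) I (ideal_grading I) D \<and> length D = length ts"
proof -
  let ?k = "Poly_Mapping.keys"
  have "\<exists>Z. \<forall>s. (\<exists>i<j. \<exists>r. s + ts ! j = r + ts ! i) \<longleftrightarrow> ?k s \<inter> Z \<noteq> {}"
    if j: "j < length ts" for j
  proof (cases "j = 0")
    case True
    \<comment> \<open>The first generator has no predecessors, so all variables stay free;
      \<open>lin\<close> starts only at index 1.\<close>
    then show ?thesis by (intro exI[of _ "{}"]) simp
  next
    case False
    then obtain Z where Z: "colon_ideal (ideal_gen (monom ` set (take j ts)))
        (monom (ts ! j) :: ('n, 'k) mpoly) = ideal_gen (var ` Z)"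
      using lin[of j] j by auto
    have "set (take j ts) = (!) ts ` {..<j}"
      using j by (simp add: nth_image lessThan_atLeast0)
    then show ?thesis
      using colon_ideal_monom_eq_vars[OF Z] by (intro exI[of _ Z]) (simp add: Bex_def)
  qed
  then obtain Z where Z: "\<And>j s. j < length ts \<Longrightarrow>
      (\<exists>i<j. \<exists>r. s + ts ! j = r + ts ! i) \<longleftrightarrow> ?k s \<inter> Z j \<noteq> {}"
    by metis
  define P where "P j = {s + ts ! j | s. ?k s \<subseteq> - Z j}" for j
  define D :: "(('n, 'k) mpoly \<times> 'n set) list" where
    "D = map (\<lambda>j. (monom (ts ! j), - Z j)) [0..<length ts]"
  \<comment> \<open>By the choice of \<open>Z j\<close>, avoiding \<open>Z j\<close> means that no
    earlier generator divides the product. Hence \<open>P j\<close> consists of the exponents whose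
    first divisor in the list has index \<open>j\<close>.\<close>
  have P: "t \<in> P j \<longleftrightarrow> (\<exists>s. t = s + ts ! j) \<and> (\<forall>i<j. \<nexists>r. t = r + ts ! i)"
    if "j < length ts" for j t
  proof -
    have "t \<in> P j \<longleftrightarrow> (\<exists>s. t = s + ts ! j \<and> \<not> (\<exists>i<j. \<exists>r. s + ts ! j = r + ts ! i))"
      using Z[OF that] by (auto simp: P_def)
    then show ?thesis by auto
  qed
  \<comment> \<open>Of two distinct indices the smaller one prevents the larger from being
    first.\<close>
  have "disjoint_family_on P {..<length ts}"
    unfolding disjoint_family_on_def by (auto simp: P) (metis linorder_neqE_nat)
  moreover have "(\<Union>j<length ts. P j) = {t. \<exists>a\<in>set ts. \<exists>s. t = s + a}"
  proof (intro set_eqI iffI)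
    fix t assume "t \<in> {t. \<exists>a\<in>set ts. \<exists>s. t = s + a}"
    then obtain a s where "a \<in> set ts" "t = s + a" by blast
    moreover from this obtain k where "k < length ts" "ts ! k = a"
      by (meson in_set_conv_nth)
    ultimately have "\<exists>j. j < length ts \<and> (\<exists>s. t = s + ts ! j)" by blast
    \<comment> \<open>The least index of a divisor selects the block that contains
      \<open>t\<close>.\<close>
    then obtain j where j: "j < length ts \<and> (\<exists>s. t = s + ts ! j)"
        "\<forall>i<j. \<not> (i < length ts \<and> (\<exists>s. t = s + ts ! i))"
      by (subst (asm) exists_least_iff) blast
    then have "t \<in> P j" by (subst P) auto
    then show "t \<in> (\<Union>j<length ts. P j)" using j by blast
  next
    fix t assume "t \<in> (\<Union>j<length ts. P j)"
    then obtain j where "j < length ts" "t \<in> P j" by blast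
    moreover from this obtain s where "t = s + ts ! j" by (auto simp: P_def)
    ultimately show "t \<in> {t. \<exists>a\<in>set ts. \<exists>s. t = s + a}"
      using nth_mem by blast
  qed
  then have "I = {g. ?k g \<subseteq> (\<Union>j<length ts. P j)}"
    unfolding I_def by (auto simp: mem_ideal_gen_monom)
  moreover have "cyclic_subspace (*) (fst (D ! j)) (snd (D ! j)) = {g. ?k g \<subseteq> P j}"
    if "j < length ts" for j
    using that by (simp add: D_def cyclic_subspace_monom P_def)
  ultimately have sum: "direct_sum_of_subspaces (*) I {..<length ts}
      (\<lambda>j. cyclic_subspace (*) (fst (D ! j)) (snd (D ! j)))"
    by (intro direct_sum_of_supports[where P = P]) auto
  have "u \<in> I \<and> (\<exists>a. u \<in> ideal_grading I a) \<and>
      free_over (*) (poly_subring W) (cyclic_subspace (*) u W)" if uW: "(u, W) \<in> set D" for u W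
  proof -
    obtain t where t: "t \<in> set ts" "u = monom t"
      using uW nth_mem by (force simp: D_def)
    then have "u \<in> I"
      unfolding I_def t monom_in_ideal_gen by (metis add_0)
    moreover have "u \<in> poly_component (\<lambda>i. int (Poly_Mapping.lookup t i))"
      by (simp add: t poly_component_def)
    ultimately show ?thesis
      using free_over_cyclic_subspace_monom by (auto simp: ideal_grading_def t)
  qed
  with sum have "stanley_decomposition (*) I (ideal_grading I) D"
    by (auto simp: stanley_decomposition_def D_def)
  then show ?thesis by (auto simp: D_def)
qed

section \<open>Combining the two bounds\<close>

theorem mainTheorem4:
  fixes I :: "('n::finite, 'k::field) mpoly set"
    and U :: "('n, 'k) mpoly set"
    and m :: nat
  assumes "monomial_ideal I"
    and "minimal_monomial_generators I U"
    and "finite U" and "card U = m"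
    and "linear_quotients I"
  shows "stanley_length (*) I (ideal_grading I) = m"
proof -
  obtain us where us: "distinct us" "minimal_monomial_generators I (set us)"
    "\<And>j. 1 \<le> j \<Longrightarrow> j < length us \<Longrightarrow>
       \<exists>Z. colon_ideal (ideal_gen (set (take j us))) (us ! j) = ideal_gen (var ` Z)"
    using assms(5) unfolding linear_quotients_def by blast
  have "set us \<subseteq> range monom"
    using us(2) by (simp add: minimal_monomial_generators_def)
  then have "us \<in> lists (range monom)" by auto
  \<comment> \<open>Passing to exponent vectors: a list of monomials is the image of a list of
    exponents.\<close>
  then obtain ts where ts: "us = map monom ts"
    unfolding lists_image by auto
  obtain A where A: "U = monom ` A"
    using assms(2) by (auto simp: minimal_monomial_generators_def subset_image_iff)
  have min: "minimal_monomial_generators I (monom ` A)"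
    "minimal_monomial_generators I (monom ` set ts)"
    using assms(2) us(2) by (simp_all add: A ts)
  \<comment> \<open>Uniqueness of the minimal generators lets the length of the ordering be computed
    as the cardinality of \<open>U\<close>.\<close>
  then have "A = set ts"
    using minimal_monomial_generators_subset by blast
  moreover have "distinct ts" using us(1) by (simp add: ts distinct_map)
  moreover have "card A = m"
    using assms(4) by (simp add: A card_image inj_on_subset[OF inj_monom])
  ultimately have m: "length ts = m" using distinct_card by metis
  have I: "I = ideal_gen (monom ` set ts)"
    using min by (simp add: minimal_monomial_generators_def)
  have "\<exists>D. stanley_decomposition (*) I (ideal_grading I) D \<and> length D = m"
    unfolding I m[symmetric]
    by (rule stanley_decomposition_linear_quotients) (use us(3) in \<open>auto simp: ts take_map\<close>)
  then show ?thesis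
    unfolding stanley_length_def
    using card_le_length_stanley_decomposition[OF min(1)] \<open>card A = m\<close>
    \<comment> \<open>The value \<open>m\<close> is attained by the decomposition above, and no
      decomposition has fewer than \<open>card A\<close> summands.\<close>
    by (intro Least_equality) auto
qed

end
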